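(* Fix an integer $d\geq 1$ and let $X=\mathbb{N}^d$. For $x\in X$ let $\mathrm{Cont}(x)=t^{n(x)}q^{W(x)}\in\mathbb{Z}[[t,q]]$. Then, as power series in $\mathbb{Z}[[t,q]]$, $$\sum_{x\in X}\mathrm{Cont}(x)=\frac{1}{(1-t)(1-tq)\cdots(1-tq^{d-1})}.$$ In particular, for all $n,W\geq 0$, the number of $x\in X$ with $n(x)=n$ and $W(x)=W$ equals the number of partitions of $W$ with at most $n$ parts, each part of size at most $d-1$.
   Context: $\mathbb{N}$ denotes the nonnegative integers and $[d]=\{1,\dots,d\}$. For $x=(n_1,\dots,n_d)\in X=\mathbb{N}^d$, its size is $n(x)=n_1+\dots+n_d$. To $x$ associate the configuration of points $\Delta(x)=\{(1,n_1),\dots,(d,n_d)\}\subseteq[d]\times\mathbb{N}$. For a point $\delta=(i,n)\in[d]\times\mathbb{N}$, its height is $h(\delta)=n+i/d$; points are linearly ordered by height ($\delta_1\prec\delta_2$ iff $h(\delta_1)<h(\delta_2)$). List $\Delta(x)=\{\delta^1(x)\prec\cdots\prec\delta^d(x)\}$ in increasing height. For $\delta_1\prec\delta_2$ define their distance $b(\delta_1,\delta_2)=\lfloor h(\delta_2)-h(\delta_1)\rfloor$. The weight of $x$ is $W(x)=\sum_{1\leq j<k\leq d} b(\delta^j(x),\delta^k(x))$. *)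

theory Defs
  imports
    "HOL-Analysis.Infinite_Sum"
    "HOL-Computational_Algebra.Formal_Power_Series"
    "HOL-Library.FuncSet"
    "HOL-Library.Multiset"
begin

definition Xset :: "nat \<Rightarrow> (nat \<Rightarrow> nat) set" where
  "Xset d = {1..d} \<rightarrow>\<^sub>E UNIV"

definition vsize :: "nat \<Rightarrow> (nat \<Rightarrow> nat) \<Rightarrow> nat" where
  "vsize d x = (\<Sum>i = 1..d. x i)"

definition points :: "nat \<Rightarrow> (nat \<Rightarrow> nat) \<Rightarrow> (nat \<times> nat) set" where
  "points d x = (\<lambda>i. (i, x i)) ` {1..d}"

definition height :: "nat \<Rightarrow> nat \<times> nat \<Rightarrow> real" where
  "height d \<delta> = real (snd \<delta>) + real (fst \<delta>) / real d"

text \<open>The point \<open>\<delta>\<^sup>j(x)\<close>, for \<open>1 \<le> j \<le> d\<close>; lists are indexed from \<open>0\<close>, hence the shift.\<close>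

definition point :: "nat \<Rightarrow> (nat \<Rightarrow> nat) \<Rightarrow> nat \<Rightarrow> nat \<times> nat" where
  "point d x j = sorted_key_list_of_set (height d) (points d x) ! (j - 1)"

text \<open>Only used when the first point is lower than the second, so that \<^const>\<open>nat\<close> does not
  truncate.\<close>

definition distance :: "nat \<Rightarrow> nat \<times> nat \<Rightarrow> nat \<times> nat \<Rightarrow> nat" where
  "distance d \<delta>1 \<delta>2 = nat \<lfloor>height d \<delta>2 - height d \<delta>1\<rfloor>"

definition weight :: "nat \<Rightarrow> (nat \<Rightarrow> nat) \<Rightarrow> nat" where
  "weight d x =
     (\<Sum>(j, k) \<in> {(j, k). 1 \<le> j \<and> j < k \<and> k \<le> d}. distance d (point d x j) (point d x k))"

text \<open>\<open>\<int>[[t,q]]\<close> is represented as \<open>\<int>[[q]][[t]]\<close>. The library topology on this type is the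
  \<open>t\<close>-adic one with discrete coefficient ring \<open>\<int>[[q]]\<close>; it is Hausdorff and finer than the
  \<open>(t,q)\<close>-adic topology, so a sum in it is also the sum coefficient by coefficient.\<close>

definition t_var :: "int fps fps" where "t_var = fps_X"

definition q_var :: "int fps fps" where "q_var = fps_const fps_X"

definition Cont :: "nat \<Rightarrow> (nat \<Rightarrow> nat) \<Rightarrow> int fps fps" where
  "Cont d x = t_var ^ vsize d x * q_var ^ weight d x"

text \<open>The operations \<^const>\<open>inverse\<close> and \<open>(/)\<close> are not available over the coefficient ring
  \<open>\<int>[[q]]\<close>. The reciprocal of a series with constant coefficient \<open>1\<close> is given by the library's
  general one-sided inverse; the lemma shows that it is the inverse in the ring.\<close>

abbreviation fps_recip :: "'a::comm_ring_1 fps \<Rightarrow> 'a fps" where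
  "fps_recip P \<equiv> fps_right_inverse P 1"

lemma fps_recip_unique:
  fixes P Q :: "'a::comm_ring_1 fps"
  assumes "fps_nth P 0 = 1"
  shows "P * Q = 1 \<longleftrightarrow> Q = fps_recip P"
proof -
  have "P * fps_recip P = 1"
    by (rule fps_right_inverse) (simp add: assms)
  then show ?thesis
    by (metis mult.assoc mult.commute mult_1)
qed

lemma denominator_nth_0: "fps_nth (\<Prod>i<d. 1 - t_var * q_var ^ i) 0 = 1"
  by (induction d) (simp_all add: t_var_def)

definition partitions :: "nat \<Rightarrow> nat multiset set" where
  "partitions W = {p. (\<forall>k \<in># p. k > 0) \<and> sum_mset p = W}"

text \<open>The heights are pairwise distinct on the relevant points, so sorting by height lists all
  the points of the configuration in strictly increasing height.\<close>

lemma inj_on_height: "inj_on (height d) ({1..d} \<times> UNIV)"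
proof (rule inj_onI, clarify)
  fix i m j n :: nat
  assume ij: "i \<in> {1..d}" "j \<in> {1..d}" and h: "height d (i, m) = height d (j, n)"
  then have "d > 0" by simp
  with h have "real m * real d + real i = real n * real d + real j"
    by (simp add: height_def field_simps)
  then have eq: "m * d + i = n * d + j"
    by (metis of_nat_add of_nat_eq_iff of_nat_mult)
  have div: "(k * d + (l - 1)) div d = k" if "l \<in> {1..d}" for k l
  proof -
    have "l - 1 < d" using that by auto
    then show ?thesis using \<open>d > 0\<close> by (simp del: One_nat_def)
  qed
  have "m * d + (i - 1) = n * d + (j - 1)"
    using eq ij by simp
  then have "m = n"
    using div[OF ij(1), of m] div[OF ij(2), of n] by simp
  with eq show "i = j \<and> m = n" by simp
qed

lemma (in linorder) sorted_key_list_of_set_inj_on: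
  assumes "inj_on f A" "finite A"
  shows "set (sorted_key_list_of_set f A) = A"
    and "length (sorted_key_list_of_set f A) = card A"
    and "sorted_wrt (<) (map f (sorted_key_list_of_set f A))"
proof -
  interpret folding_insort_key "(\<le>)" "(<)" A f
    by unfold_locales (rule assms)
  show "set (sorted_key_list_of_set f A) = A"
    using assms by simp
  show "length (sorted_key_list_of_set f A) = card A"
    by simp
  show "sorted_wrt (<) (map f (sorted_key_list_of_set f A))"
    by simp
qed

lemma sorted_points:
  fixes d :: nat and x :: "nat \<Rightarrow> nat"
  defines "l \<equiv> sorted_key_list_of_set (height d) (points d x)"
  shows "set l = points d x" and "length l = d" and "sorted_wrt (<) (map (height d) l)"
proof -
  have "inj_on (height d) (points d x)"
    by (rule inj_on_subset[OF inj_on_height]) (auto simp: points_def)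
  moreover have "finite (points d x)"
    by (simp add: points_def)
  moreover have "card (points d x) = d"
    unfolding points_def by (subst card_image) (auto simp: inj_on_def)
  ultimately show "set l = points d x" "length l = d" "sorted_wrt (<) (map (height d) l)"
    using sorted_key_list_of_set_inj_on[of "height d" "points d x"] by (simp_all add: l_def)
qed

end

theory Submission
  imports Defs
begin

text \<open>Raise one point of a configuration by \<open>1\<close> so that it becomes the highest. If \<open>k\<close> points lie
  below it, the size grows by \<open>1\<close> and the weight by \<open>k\<close>, and afterwards exactly \<open>k\<close> points are at
  distance at least \<open>1\<close> from the top; call this number the spread. The point with \<open>k\<close> points below
  it can become the highest in this way iff \<open>k\<close> is at least the current spread, and lowering the
  highest point undoes the step. So every configuration arises from the zero one by a unique weakly
  increasing sequence of steps \<open>k < d\<close>, each contributing a factor \<open>t q\<^sup>k\<close>. Counting configurations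
  by size, weight and a bound on the spread gives the recursion of the partitions in a box.\<close>

section \<open>Integer levels, ranks, spread, and the weight in terms of levels\<close>

text \<open>The height scaled by \<open>d\<close>, so that comparisons stay in the naturals and
  distance 1 becomes a level difference of \<open>d\<close>.\<close>

definition level :: "nat \<Rightarrow> (nat \<Rightarrow> nat) \<Rightarrow> nat \<Rightarrow> nat" where
  "level d x i = d * x i + i"

definition rank :: "nat \<Rightarrow> (nat \<Rightarrow> nat) \<Rightarrow> nat \<Rightarrow> nat" where
  "rank d x i = card {j \<in> {1..d}. level d x j < level d x i}"

text \<open>Strict inequality still means distance at least 1, since two levels never differ by
  exactly \<open>d\<close>. Quantifying over \<open>i\<close> avoids naming the highest
  point.\<close>

definition spread :: "nat \<Rightarrow> (nat \<Rightarrow> nat) \<Rightarrow> nat" where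
  "spread d x = card {j \<in> {1..d}. \<exists>i \<in> {1..d}. level d x j + d < level d x i}"

definition config_count :: "nat \<Rightarrow> nat \<Rightarrow> nat \<Rightarrow> nat \<Rightarrow> nat" where
  "config_count d n W k = card {x \<in> Xset d. vsize d x = n \<and> weight d x = W \<and> spread d x \<le> k}"

lemma level_eq_height: "d \<ge> 1 \<Longrightarrow> real (level d x i) = d * height d (i, x i)"
  by (simp add: level_def height_def field_simps)

text \<open>Indices in \<open>{1..d}\<close> are distinct modulo \<open>d\<close>. This is read off
  from injectivity of the height, applied to point \<open>i\<close> raised by
  \<open>m\<close>.\<close>

lemma level_add_eqD:
  assumes "i \<in> {1..d}" "j \<in> {1..d}" "level d x i + d * m = level d x j"
  shows "i = j"
proof -
  have "height d (i, x i + m) = height d (j, x j)"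
  proof -
    have "real (d * (x i + m) + i) = real (d * x j + j)"
      using assms(3) by (simp only: level_def) (simp only: algebra_simps)
    then have "real (x i + m) * real d + real i = real (x j) * real d + real j"
      by (simp only: of_nat_add of_nat_mult mult.commute)
    then have "(real (x i + m) * real d + real i) / real d = (real (x j) * real d + real j) / real d"
      by (rule arg_cong)
    then show ?thesis using assms(1) unfolding height_def add_divide_distrib by simp
  qed
  then show ?thesis
    using inj_onD[OF inj_on_height, of d "(i, x i + m)" "(j, x j)"] assms by simp
qed

lemma level_eqD: "i \<in> {1..d} \<Longrightarrow> j \<in> {1..d} \<Longrightarrow> level d x i = level d x j \<Longrightarrow> i = j"
  using level_add_eqD[of i d j x 0] by simp

text \<open>Rank is strictly monotone in the level and levels are distinct, so injectivity follows
  and counting gives surjectivity. It provides the unique point with \<open>k\<close> points below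
  it.\<close>

lemma bij_betw_rank: "bij_betw (rank d x) {1..d} {..<d}"
proof -
  have mono: "rank d x i < rank d x j"
    if "i \<in> {1..d}" "level d x i < level d x j" for i j
    unfolding rank_def by (rule psubset_card_mono) (use that in auto)
  have inj: "inj_on (rank d x) {1..d}"
  proof (rule inj_onI)
    fix i j assume ij: "i \<in> {1..d}" "j \<in> {1..d}" "rank d x i = rank d x j"
    then have "level d x i = level d x j"
      using mono[of i j] mono[of j i] by (metis less_irrefl linorder_neqE_nat)
    with ij show "i = j" by (blast intro: level_eqD)
  qed
  have "rank d x i < d" if "i \<in> {1..d}" for i
  proof -
    have "{j \<in> {1..d}. level d x j < level d x i} \<subset> {1..d}"
      using that by blast
    then have "rank d x i < card {1..d}"
      unfolding rank_def by (rule psubset_card_mono[OF finite_atLeastAtMost])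
    then show ?thesis by simp
  qed
  then have "rank d x ` {1..d} \<subseteq> {..<d}" by auto
  moreover have "card (rank d x ` {1..d}) = card {..<d}"
    using inj by (simp add: card_image)
  ultimately have "rank d x ` {1..d} = {..<d}"
    by (intro card_subset_eq) auto
  with inj show ?thesis by (simp add: bij_betw_def)
qed

text \<open>The highest point is never among those counted.\<close>

lemma spread_less:
  assumes "d \<ge> 1"
  shows "spread d x < d"
proof -
  let ?T = "Max (level d x ` {1..d})"
  have "?T \<in> level d x ` {1..d}" using assms by (intro Max_in) auto
  then obtain t where t: "t \<in> {1..d}" "level d x t = ?T" by (metis imageE)
  then have "level d x i \<le> level d x t" if "i \<in> {1..d}" for i using that by simp
  then have "\<not> (\<exists>i \<in> {1..d}. level d x t + d < level d x i)" by force
  then have "spread d x < card {1..d}"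
    unfolding spread_def using t(1) by (intro psubset_card_mono) auto
  then show ?thesis by simp
qed

text \<open>Each unordered pair contributes once: for the other order the truncated difference is \<open>0\<close>.\<close>

lemma weight_eq_sum_level:
  assumes "d \<ge> 1"
  shows "weight d x = (\<Sum>i = 1..d. \<Sum>j = 1..d. (level d x j - level d x i) div d)"
proof -
  have dist_eq: "distance d (i, x i) (j, x j) = (level d x j - level d x i) div d" for i j
  proof -
    have eq: "height d (j, x j) - height d (i, x i) = (real (level d x j) - real (level d x i)) / d"
      using assms by (simp add: level_eq_height field_simps)
    show ?thesis
    proof (cases "level d x i \<le> level d x j")
      case True
      then have "distance d (i, x i) (j, x j) = nat \<lfloor>real (level d x j - level d x i) / real d\<rfloor>"
        unfolding distance_def eq by simp
      then show ?thesis by (simp add: floor_divide_of_nat_eq)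
    next
      case False
      then have "(real (level d x j) - real (level d x i)) / d \<le> 0"
        by (simp add: divide_nonpos_nonneg)
      then have "\<lfloor>(real (level d x j) - real (level d x i)) / d\<rfloor> \<le> 0"
        by linarith
      then show ?thesis using False unfolding distance_def eq by simp
    qed
  qed
  define l where "l = sorted_key_list_of_set (height d) (points d x)"
  note l = sorted_points[where d = d and x = x, folded l_def]
  have srt: "height d (l ! j) < height d (l ! k)" if "j < k" "k < d" for j k
    using l(2) sorted_wrt_nth_less[OF l(3), of j k] that by simp
  then have dist0: "distance d (l ! j) (l ! k) = 0" if "k \<le> j" "j < d" for j k
  proof -
    have "height d (l ! k) \<le> height d (l ! j)"
      using that srt[of k j] by (cases "k = j") auto
    then show ?thesis by (simp add: distance_def)
  qed
  have "distinct l"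
    using l(3) strict_sorted_iff distinct_map by blast
  then have bij: "bij_betw ((!) l) {..<d} (points d x)"
    using l bij_betw_nth by blast
  have "weight d x = (\<Sum>(j, k) \<in> {(j, k). j < k \<and> k < d}. distance d (l ! j) (l ! k))"
    unfolding weight_def point_def l_def[symmetric]
    by (rule sum.reindex_bij_witness[of _ "\<lambda>(j, k). (Suc j, Suc k)" "\<lambda>(j, k). (j - 1, k - 1)"]) auto
  \<comment> \<open>Distances with \<open>k \<le> j\<close> are 0. On the full square the order of
    the list no longer matters, so the sum can be reindexed by the points.\<close>
  also have "\<dots> = (\<Sum>(j, k) \<in> {..<d} \<times> {..<d}. distance d (l ! j) (l ! k))"
    by (rule sum.mono_neutral_left) (auto, metis dist0 not_le less_irrefl)
  also have "\<dots> = (\<Sum>j<d. \<Sum>k<d. distance d (l ! j) (l ! k))"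
    by (simp add: sum.cartesian_product)
  also have "\<dots> = (\<Sum>a\<in>points d x. \<Sum>b\<in>points d x. distance d a b)"
    by (simp add: sum.reindex_bij_betw[OF bij, symmetric])
  also have "\<dots> = (\<Sum>i = 1..d. \<Sum>j = 1..d. distance d (i, x i) (j, x j))"
    unfolding points_def by (simp add: sum.reindex inj_on_def)
  also have "\<dots> = (\<Sum>i = 1..d. \<Sum>j = 1..d. (level d x j - level d x i) div d)"
    by (simp only: dist_eq)
  finally show ?thesis .
qed

section \<open>Raising a point to the top and undoing it\<close>

text \<open>Isolates the row and column of \<open>p\<close>, the only terms of the weight that
  change when point \<open>p\<close> moves.\<close>

lemma sum_sum_remove:
  fixes g :: "'a \<Rightarrow> 'a \<Rightarrow> 'b::comm_monoid_add"
  assumes "finite A" "p \<in> A"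
  shows "(\<Sum>i\<in>A. \<Sum>j\<in>A. g i j) =
    g p p + (\<Sum>j\<in>A - {p}. g p j) + ((\<Sum>i\<in>A - {p}. g i p) + (\<Sum>i\<in>A - {p}. \<Sum>j\<in>A - {p}. g i j))"
  by (simp add: sum.remove[OF assms] sum.distrib ac_simps)

text \<open>The bound on the spread puts every point less than \<open>d\<close> above
  \<open>p\<close>. Raising \<open>p\<close> thus adds 1 to its distance from each point below it
  and leaves all other distances unchanged.\<close>

lemma raise:
  assumes d: "d \<ge> 1" and y: "y \<in> Xset d" and p: "p \<in> {1..d}" and k: "spread d y \<le> rank d y p"
  defines "x \<equiv> y(p := Suc (y p))"
  shows "x \<in> Xset d" "vsize d x = Suc (vsize d y)" "spread d x = rank d y p"
    "weight d x = weight d y + rank d y p" "i \<in> {1..d} \<Longrightarrow> level d x i \<le> level d x p"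
proof -
  show "x \<in> Xset d"
    using y p by (auto simp: Xset_def x_def PiE_def extensional_def)
  show "vsize d x = Suc (vsize d y)"
    using p by (simp add: vsize_def x_def sum.remove[of _ p])
  have lx: "level d x i = (if i = p then level d y p + d else level d y i)" for i
    by (simp add: x_def level_def)
  \<comment> \<open>Otherwise \<open>p\<close> and all points below it would count towards the
    spread, making it at least \<open>rank d y p + 1\<close>.\<close>
  have window: "level d y j < level d y p + d" if j: "j \<in> {1..d}" for j
  proof (rule ccontr)
    assume "\<not> level d y j < level d y p + d"
    moreover have "level d y j \<noteq> level d y p + d"
      using level_add_eqD[OF p j, of y 1] d by auto
    ultimately have "level d y p + d < level d y j" by simp
    then have "insert p {i \<in> {1..d}. level d y i < level d y p} \<subseteq>
        {j \<in> {1..d}. \<exists>i \<in> {1..d}. level d y j + d < level d y i}"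
      using p j by (auto intro!: bexI[of _ j])
    then have "card (insert p {i \<in> {1..d}. level d y i < level d y p}) \<le> spread d y"
      unfolding spread_def by (rule card_mono[rotated]) simp
    then have "Suc (rank d y p) \<le> spread d y"
      by (simp add: rank_def)
    with k show False by simp
  qed
  show top: "level d x i \<le> level d x p" if "i \<in> {1..d}" for i
    using window[OF that] by (simp add: lx)
  \<comment> \<open>As \<open>p\<close> is now highest, it can serve as the witness
    \<open>i\<close>; the shift by \<open>d\<close> then cancels.\<close>
  have "{j \<in> {1..d}. \<exists>i \<in> {1..d}. level d x j + d < level d x i} =
      {j \<in> {1..d}. level d x j + d < level d x p}"
    using top p by (force intro: order.strict_trans2)
  also have "\<dots> = {j \<in> {1..d}. level d y j < level d y p}"
    by (auto simp: lx)
  finally show "spread d x = rank d y p"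
    by (simp add: spread_def rank_def)
  let ?I = "{1..d} - {p}"
  \<comment> \<open>A point below \<open>p\<close> gains a full \<open>d\<close>. A point above
    \<open>p\<close> had truncated difference 0 and now lies less than \<open>d\<close> below
    \<open>p\<close>.\<close>
  have "(level d x p - level d x i) div d =
      (level d y p - level d y i) div d + (if level d y i < level d y p then 1 else 0)"
    if i: "i \<in> ?I" for i
  proof (cases "level d y i < level d y p")
    case True
    then have "level d x p - level d x i = (level d y p - level d y i) + d"
      using i by (simp add: lx)
    moreover have "(a + d) div d = a div d + 1" for a
      using d by simp
    ultimately show ?thesis using True by presburger
  next
    case False
    then have "level d y p < level d y i"
      using level_eqD[of i d p y] i p by (metis Diff_iff insertI1 linorder_neqE_nat)
    moreover from this d have "level d y p + d - level d y i < d" by linarith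
    ultimately show ?thesis using i by (simp add: lx)
  qed
  then have "(\<Sum>i\<in>?I. (level d x p - level d x i) div d) =
      (\<Sum>i\<in>?I. (level d y p - level d y i) div d) +
      (\<Sum>i\<in>?I. if level d y i < level d y p then 1 else 0)"
    by (simp add: sum.distrib)
  also have "(\<Sum>i\<in>?I. if level d y i < level d y p then 1 else (0::nat)) = rank d y p"
  proof -
    have "?I \<inter> {i. level d y i < level d y p} = {i \<in> {1..d}. level d y i < level d y p}"
      by auto
    then show ?thesis by (simp add: sum.If_cases rank_def)
  qed
  finally have row: "(\<Sum>i\<in>?I. (level d x p - level d x i) div d) =
      (\<Sum>i\<in>?I. (level d y p - level d y i) div d) + rank d y p" .
  have col_x: "(\<Sum>j\<in>?I. (level d x j - level d x p) div d) = 0"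
    using top by simp
  \<comment> \<open>By the window, points above \<open>p\<close> were at distance 0 from it, so no
    weight is lost when \<open>p\<close> passes them.\<close>
  have col_y: "(\<Sum>j\<in>?I. (level d y j - level d y p) div d) = 0"
  proof (rule sum.neutral, rule ballI)
    fix j assume "j \<in> ?I"
    then show "(level d y j - level d y p) div d = 0"
      using window[of j] d by (intro div_less) auto
  qed
  have rest: "(\<Sum>i\<in>?I. \<Sum>j\<in>?I. (level d x j - level d x i) div d) =
      (\<Sum>i\<in>?I. \<Sum>j\<in>?I. (level d y j - level d y i) div d)"
    by (intro sum.cong refl) (simp add: lx)
  show "weight d x = weight d y + rank d y p"
    unfolding weight_eq_sum_level[OF d] sum_sum_remove[OF finite_atLeastAtMost p] row col_x col_y rest
    by simp
qed

text \<open>The point \<open>p\<close> is the highest one of \<open>x\<close>. The last two facts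
  say that the step back to \<open>x\<close> meets the hypothesis of \<open>raise\<close>.\<close>

lemma lower:
  assumes d: "d \<ge> 1" and x: "x \<in> Xset d" "vsize d x > 0"
  obtains y p where "y \<in> Xset d" "p \<in> {1..d}" "x = y(p := Suc (y p))"
    "rank d y p = spread d x" "spread d y \<le> spread d x"
proof -
  let ?T = "Max (level d x ` {1..d})"
  have "?T \<in> level d x ` {1..d}" using d by (intro Max_in) auto
  then obtain p where p: "p \<in> {1..d}" "level d x p = ?T" by (metis imageE)
  then have top: "level d x i \<le> level d x p" if "i \<in> {1..d}" for i using that by simp
  obtain i where i: "i \<in> {1..d}" "x i > 0"
    using x(2) unfolding vsize_def by (metis gr0I less_numeral_extra(3) sum.neutral)
  \<comment> \<open>A point with coordinate 0 has level at most \<open>d\<close>, and one with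
    positive coordinate has level above \<open>d\<close>.\<close>
  have "x p > 0"
  proof (rule ccontr)
    assume "\<not> x p > 0"
    then have "level d x p \<le> d" using p by (simp add: level_def)
    moreover have "d < d * x i + i" using i
      by (cases "x i") auto
    ultimately show False using top[OF i(1)] by (simp add: level_def)
  qed
  define y where "y = x(p := x p - 1)"
  have x_eq: "x = y(p := Suc (y p))" using \<open>x p > 0\<close> by (auto simp: y_def)
  have lx: "level d x i = (if i = p then level d y p + d else level d y i)" for i
    by (subst x_eq) (simp add: level_def)
  show ?thesis
  proof
    show "y \<in> Xset d" using x(1) p by (auto simp: Xset_def y_def PiE_def extensional_def)
    show "p \<in> {1..d}" "x = y(p := Suc (y p))" by fact+
    have "{j \<in> {1..d}. \<exists>i \<in> {1..d}. level d x j + d < level d x i} =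
        {j \<in> {1..d}. level d x j + d < level d x p}"
      using top p(1) by (force intro: order.strict_trans2)
    also have "\<dots> = {j \<in> {1..d}. level d y j < level d y p}"
      by (auto simp: lx)
    finally show "rank d y p = spread d x"
      by (simp add: spread_def rank_def)
    \<comment> \<open>No point exceeds the lowered \<open>p\<close> by more than \<open>d\<close>,
      so a counted \<open>j\<close> differs from \<open>p\<close>. Its level is the same in
      \<open>x\<close>, where its witness is at least as high.\<close>
    show "spread d y \<le> spread d x"
      unfolding spread_def
    proof (intro card_mono subsetI)
      fix j assume "j \<in> {j \<in> {1..d}. \<exists>i\<in>{1..d}. level d y j + d < level d y i}"
      then obtain i where ij: "j \<in> {1..d}" "i \<in> {1..d}" "level d y j + d < level d y i" by auto
      then have "j \<noteq> p" using top[of i] by (auto simp: lx split: if_splits)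
      with ij have "level d x j + d < level d x i" by (auto simp: lx)
      with ij show "j \<in> {j \<in> {1..d}. \<exists>i\<in>{1..d}. level d x j + d < level d x i}" by auto
    qed simp
  qed
qed

text \<open>The map raises the unique point of rank \<open>k\<close>. Its image has that point on
  top, which gives injectivity; surjectivity is \<open>lower\<close>.\<close>

lemma bij_betw_raise:
  assumes d: "d \<ge> 1" and k: "k < d"
  defines "f \<equiv> \<lambda>y. let p = THE p. p \<in> {1..d} \<and> rank d y p = k in y(p := Suc (y p))"
  shows "bij_betw f {y \<in> Xset d. vsize d y = n \<and> weight d y = W \<and> spread d y \<le> k}
    {x \<in> Xset d. vsize d x = Suc n \<and> weight d x = W + k \<and> spread d x = k}"
    (is "bij_betw f ?A ?B")
proof -
  have f_eq: "f y = y(p := Suc (y p))" if "p \<in> {1..d}" "rank d y p = k" for y p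
  proof -
    have "(THE p. p \<in> {1..d} \<and> rank d y p = k) = p"
      using that bij_betw_imp_inj_on[OF bij_betw_rank, of d y]
      by (intro the_equality) (auto dest: inj_onD)
    then show ?thesis by (simp add: f_def)
  qed
  have rank_ex: "\<exists>p \<in> {1..d}. rank d y p = k" for y
    using bij_betw_imp_surj_on[OF bij_betw_rank, of d y] k by (metis imageE lessThan_iff)
  show ?thesis
  proof (rule bij_betw_imageI)
    show "inj_on f ?A"
    proof (rule inj_onI)
      fix y z assume y: "y \<in> ?A" and z: "z \<in> ?A" and eq: "f y = f z"
      obtain p where p: "p \<in> {1..d}" "rank d y p = k" using rank_ex by blast
      obtain r where r: "r \<in> {1..d}" "rank d z r = k" using rank_ex by blast
      \<comment> \<open>The raised points \<open>p\<close> and \<open>r\<close> are both highest in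
        the common image, hence equal.\<close>
      have "level d (f y) r \<le> level d (f y) p"
        unfolding f_eq[OF p] using y p r by (intro raise(5)) (use d in auto)
      moreover have "level d (f z) p \<le> level d (f z) r"
        unfolding f_eq[OF r] using z p r by (intro raise(5)) (use d in auto)
      ultimately have "p = r" using level_eqD[OF p(1) r(1), of "f y"] eq by simp
      with eq have "y(p := Suc (y p)) = z(p := Suc (z p))"
        using p r by (simp add: f_eq)
      then show "y = z" by (metis fun_upd_apply fun_upd_triv fun_upd_upd nat.inject)
    qed
    show "f ` ?A = ?B"
    proof (intro equalityI subsetI)
      fix x assume "x \<in> f ` ?A"
      then obtain y where y: "y \<in> ?A" "x = f y" by blast
      obtain p where p: "p \<in> {1..d}" "rank d y p = k" using rank_ex by blast
      show "x \<in> ?B" unfolding y(2) f_eq[OF p] using raise(1-4)[OF d _ p(1), of y] y p by auto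
    next
      fix x assume x: "x \<in> ?B"
      then obtain y p where yp: "y \<in> Xset d" "p \<in> {1..d}" "x = y(p := Suc (y p))"
        "rank d y p = spread d x" "spread d y \<le> spread d x"
        using lower[OF d, of x] by auto
      then have "x = f y" using f_eq[of p y] x by simp
      moreover have "y \<in> ?A" using raise(1-4)[OF d yp(1,2)] yp x by auto
      ultimately show "x \<in> f ` ?A" by blast
    qed
  qed
qed

section \<open>Recursion for the number of configurations\<close>

lemma finite_vsize_le: "finite {x \<in> Xset d. vsize d x \<le> n}"
proof (rule finite_subset)
  show "{x \<in> Xset d. vsize d x \<le> n} \<subseteq> {1..d} \<rightarrow>\<^sub>E {..n}"
  proof clarify
    fix x assume x: "x \<in> Xset d" "vsize d x \<le> n"
    have "x i \<le> n" if "i \<in> {1..d}" for i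
      using member_le_sum[OF that, of x] x(2) unfolding vsize_def by simp
    with x(1) show "x \<in> {1..d} \<rightarrow>\<^sub>E {..n}" by (auto simp: Xset_def PiE_iff)
  qed
qed (simp add: finite_PiE)

lemma finite_vsize_eq: "finite {x \<in> Xset d. vsize d x = n \<and> P x}"
  by (rule finite_subset[OF _ finite_vsize_le[of d n]]) auto

text \<open>The levels of the zero configuration are \<open>1\<close> to \<open>d\<close>, all less
  than \<open>d\<close> apart.\<close>

lemma config_count_0:
  assumes "d \<ge> 1"
  shows "config_count d 0 W k = (if W = 0 then 1 else 0)"
proof -
  \<comment> \<open>Members of \<open>Xset d\<close> are undefined outside \<open>{1..d}\<close>,
    hence the restriction.\<close>
  define z where "z = restrict (\<lambda>_. 0::nat) {1..d}"
  have eq: "x = z" if "x \<in> Xset d" "vsize d x = 0" for x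
    by (rule PiE_ext[of _ "{1..d}" "\<lambda>_. UNIV"]) (use that in \<open>auto simp: z_def Xset_def vsize_def\<close>)
  have z: "z \<in> Xset d" "vsize d z = 0" by (auto simp: z_def Xset_def vsize_def)
  have lz: "level d z i = i" if "i \<in> {1..d}" for i using that by (simp add: z_def level_def)
  have "weight d z = 0"
    unfolding weight_eq_sum_level[OF assms] by (intro sum.neutral ballI) (auto simp: lz)
  moreover have "spread d z = 0"
    unfolding spread_def by (auto simp: lz)
  ultimately have "{x \<in> Xset d. vsize d x = 0 \<and> weight d x = W \<and> spread d x \<le> k} =
      (if W = 0 then {z} else {})"
    using z by (auto dest: eq)
  then show ?thesis by (simp add: config_count_def)
qed

text \<open>Undoes the last step, which alone contributes \<open>k\<close> to the weight; hence the
  value 0 for \<open>k > W\<close>.\<close>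

lemma card_spread_eq:
  assumes "d \<ge> 1" "k < d"
  shows "card {x \<in> Xset d. vsize d x = Suc n \<and> weight d x = W \<and> spread d x = k} =
    (if k \<le> W then config_count d n (W - k) k else 0)"
proof (cases "k \<le> W")
  case True
  then show ?thesis
    using bij_betw_same_card[OF bij_betw_raise[OF assms, of n "W - k"]] by (simp add: config_count_def)
next
  case False
  have "weight d x \<noteq> W" if "x \<in> Xset d" "vsize d x = Suc n" "spread d x = k" for x
    using lower[of d x] raise(4) assms that False
    by (metis add.commute le_add1 zero_less_Suc)
  then have "{x \<in> Xset d. vsize d x = Suc n \<and> weight d x = W \<and> spread d x = k} = {}"
    by auto
  with False show ?thesis by (simp only: card.empty) simp
qed

lemma config_count_Suc_0: "d \<ge> 1 \<Longrightarrow> config_count d (Suc n) W 0 = config_count d n W 0"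
  using card_spread_eq[of d 0 n W] by (simp add: config_count_def)

text \<open>Splits according to whether the last step equals the bound \<open>Suc k\<close> or is
  smaller.\<close>

lemma config_count_Suc_Suc:
  assumes "d \<ge> 1" "Suc k < d"
  shows "config_count d (Suc n) W (Suc k) =
    config_count d (Suc n) W k + (if Suc k \<le> W then config_count d n (W - Suc k) (Suc k) else 0)"
proof -
  have "{x \<in> Xset d. vsize d x = Suc n \<and> weight d x = W \<and> spread d x \<le> Suc k} =
    {x \<in> Xset d. vsize d x = Suc n \<and> weight d x = W \<and> spread d x \<le> k} \<union>
    {x \<in> Xset d. vsize d x = Suc n \<and> weight d x = W \<and> spread d x = Suc k}"
    by auto
  moreover have "card (\<dots>) =
    card {x \<in> Xset d. vsize d x = Suc n \<and> weight d x = W \<and> spread d x \<le> k} +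
    card {x \<in> Xset d. vsize d x = Suc n \<and> weight d x = W \<and> spread d x = Suc k}"
    by (rule card_Un_disjoint[OF finite_vsize_eq finite_vsize_eq]) auto
  ultimately show ?thesis
    by (simp only: card_spread_eq[OF assms] config_count_def)
qed

section \<open>Partitions in a box\<close>

definition box_partitions :: "nat \<Rightarrow> nat \<Rightarrow> nat \<Rightarrow> nat multiset set" where
  "box_partitions n W k = {p \<in> partitions W. size p \<le> n \<and> (\<forall>j \<in># p. j \<le> k)}"

lemma box_partitions_trivial:
  "n = 0 \<or> k = 0 \<Longrightarrow> box_partitions n W k = (if W = 0 then {{#}} else {})"
proof -
  assume nk: "n = 0 \<or> k = 0"
  have "p = {#}" if "p \<in> box_partitions n W k" for p
  proof (rule ccontr)
    assume "p \<noteq> {#}"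
    then obtain j where "j \<in># p" by (meson multiset_nonemptyE)
    with that nk \<open>p \<noteq> {#}\<close> show False by (force simp: box_partitions_def partitions_def)
  qed
  moreover have "{#} \<in> box_partitions n W k \<longleftrightarrow> W = 0"
    by (auto simp: box_partitions_def partitions_def)
  ultimately show ?thesis by auto
qed

text \<open>Either no part equals \<open>Suc k\<close>, or one such part is removed; this mirrors
  \<open>config_count_Suc_Suc\<close>.\<close>

lemma box_partitions_Suc_Suc:
  "box_partitions (Suc n) W (Suc k) = box_partitions (Suc n) W k \<union>
    (if Suc k \<le> W then add_mset (Suc k) ` box_partitions n (W - Suc k) (Suc k) else {})"
    (is "?L = ?R1 \<union> ?R2")
proof (intro equalityI subsetI)
  fix p assume p: "p \<in> ?L"
  show "p \<in> ?R1 \<union> ?R2"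
  proof (cases "Suc k \<in># p")
    case True
    then obtain r where r: "p = add_mset (Suc k) r" by (metis insert_DiffM)
    then have "Suc k \<le> W" "r \<in> box_partitions n (W - Suc k) (Suc k)"
      using p by (auto simp: box_partitions_def partitions_def)
    with r show ?thesis by simp
  next
    case False
    then show ?thesis using p by (auto simp: box_partitions_def le_Suc_eq)
  qed
next
  fix p assume "p \<in> ?R1 \<union> ?R2"
  then show "p \<in> ?L"
    by (auto simp: box_partitions_def partitions_def split: if_splits)
qed

lemma finite_box_partitions: "finite (box_partitions n W k)"
proof (induction n arbitrary: W k)
  case 0
  then show ?case by (simp add: box_partitions_trivial)
next
  case (Suc n)
  show ?case
    by (induction k) (simp_all add: box_partitions_trivial box_partitions_Suc_Suc Suc.IH)
qed

text \<open>Both sides obey the same recursion and boundary values. Steps with \<open>k = 0\<close>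
  account for partitions with fewer than \<open>n\<close> parts.\<close>

lemma config_count_eq_card_box_partitions:
  assumes "d \<ge> 1" "k < d"
  shows "config_count d n W k = card (box_partitions n W k)"
  using assms(2)
proof (induction n arbitrary: W k)
  case 0
  then show ?case using assms(1) by (simp add: config_count_0 box_partitions_trivial)
next
  case (Suc n)
  \<comment> \<open>The outer hypothesis, for all \<open>W\<close> and all bounds below
    \<open>d\<close>, is named before the inner induction reuses \<open>Suc.IH\<close>.\<close>
  note IH = Suc.IH
  from Suc.prems show ?case
  proof (induction k)
    case 0
    then show ?case using IH[of 0 W] assms(1) by (simp add: config_count_Suc_0 box_partitions_trivial)
  next
    case (Suc k)
    have "box_partitions (Suc n) W k \<inter> add_mset (Suc k) ` A = {}" for A
      by (auto simp: box_partitions_def)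
    then have "card (box_partitions (Suc n) W (Suc k)) = card (box_partitions (Suc n) W k) +
        (if Suc k \<le> W then card (box_partitions n (W - Suc k) (Suc k)) else 0)"
      by (simp add: box_partitions_Suc_Suc card_Un_disjoint finite_box_partitions
          card_image inj_on_def)
    then show ?case
      using Suc.IH Suc.prems IH by (simp add: config_count_Suc_Suc[OF assms(1)])
  qed
qed

section \<open>Generating functions and summation\<close>

definition count_fps :: "nat \<Rightarrow> nat \<Rightarrow> int fps fps" where
  "count_fps d k = Abs_fps (\<lambda>n. Abs_fps (\<lambda>W. int (config_count d n W k)))"

text \<open>Turns multiplication by one factor of the denominator into the shape of the recursion
  for \<open>config_count\<close>.\<close>

lemma nth_factor_mult:
  "fps_nth (fps_nth ((1 - t_var * q_var ^ k) * F) n) W = fps_nth (fps_nth F n) W -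
    (if 1 \<le> n \<and> k \<le> W then fps_nth (fps_nth F (n - 1)) (W - k) else 0)"
proof -
  have "(1 - t_var * q_var ^ k) * F = F - fps_X * (fps_const (fps_X ^ k) * F)"
    by (simp add: t_var_def q_var_def algebra_simps)
  then show ?thesis by (auto simp: fps_X_power_mult_nth)
qed

text \<open>The product telescopes: the factor with exponent \<open>Suc k\<close> turns
  \<open>count_fps d (Suc k)\<close> into \<open>count_fps d k\<close>, and \<open>1 - t_var\<close>
  turns \<open>count_fps d 0\<close> into 1.\<close>

lemma prod_mult_count_fps:
  assumes "d \<ge> 1" "k < d"
  shows "(\<Prod>i<Suc k. 1 - t_var * q_var ^ i) * count_fps d k = 1"
  using assms(2)
proof (induction k)
  case 0
  have "(1 - t_var * q_var ^ 0) * count_fps d 0 = 1"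
  proof (intro fps_ext)
    fix n W
    show "fps_nth (fps_nth ((1 - t_var * q_var ^ 0) * count_fps d 0) n) W = fps_nth (fps_nth 1 n) W"
      unfolding nth_factor_mult
      by (cases n) (simp_all add: count_fps_def config_count_0[OF assms(1)] config_count_Suc_0[OF assms(1)])
  qed
  then show ?case by simp
next
  case (Suc k)
  have "(1 - t_var * q_var ^ Suc k) * count_fps d (Suc k) = count_fps d k"
  proof (intro fps_ext)
    fix n W
    show "fps_nth (fps_nth ((1 - t_var * q_var ^ Suc k) * count_fps d (Suc k)) n) W =
        fps_nth (fps_nth (count_fps d k) n) W"
      unfolding nth_factor_mult using Suc.prems
      by (cases n) (simp_all add: count_fps_def config_count_0[OF assms(1)] config_count_Suc_Suc[OF assms(1)])
  qed
  with Suc show ?case by (simp only: prod.lessThan_Suc[of _ "Suc k"] mult.assoc)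
qed

lemma nth_Cont: "fps_nth (fps_nth (Cont d x) n) W = (if vsize d x = n \<and> weight d x = W then 1 else 0)"
  by (auto simp: Cont_def t_var_def q_var_def fps_X_power_mult_nth)

text \<open>Convergence is checked on each coefficient of \<open>t\<close>: the \<open>n\<close>-th
  is constant once the finite index set contains all configurations of size at most
  \<open>n\<close>.\<close>

lemma Cont_has_sum: "(Cont d has_sum Abs_fps (\<lambda>n. Abs_fps (\<lambda>W.
    int (card {x \<in> Xset d. vsize d x = n \<and> weight d x = W})))) (Xset d)"
  unfolding has_sum_def
proof (rule tendsto_fpsI)
  fix n
  let ?S = "\<lambda>n W. {x \<in> Xset d. vsize d x = n \<and> weight d x = W}"
  have "fps_nth (sum (Cont d) Y) n = Abs_fps (\<lambda>W. int (card (?S n W)))"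
    if Y: "finite Y" "{x \<in> Xset d. vsize d x \<le> n} \<subseteq> Y" "Y \<subseteq> Xset d" for Y
  proof (rule fps_ext)
    fix W
    have "fps_nth (fps_nth (sum (Cont d) Y) n) W =
        (\<Sum>x\<in>Y. if vsize d x = n \<and> weight d x = W then 1 else 0)"
      by (simp add: fps_sum_nth nth_Cont)
    also have "\<dots> = int (card (Y \<inter> {x. vsize d x = n \<and> weight d x = W}))"
      using Y(1) by (simp add: sum.If_cases)
    also have "Y \<inter> {x. vsize d x = n \<and> weight d x = W} = ?S n W"
      using Y by auto
    finally show "fps_nth (fps_nth (sum (Cont d) Y) n) W =
        fps_nth (Abs_fps (\<lambda>W. int (card (?S n W)))) W" by simp
  qed
  then show "\<forall>\<^sub>F Y in finite_subsets_at_top (Xset d). fps_nth (sum (Cont d) Y) n =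
      fps_nth (Abs_fps (\<lambda>n. Abs_fps (\<lambda>W. int (card (?S n W))))) n"
    unfolding eventually_finite_subsets_at_top
    by (intro exI[of _ "{x \<in> Xset d. vsize d x \<le> n}"]) (auto simp: finite_vsize_le)
qed

theorem theorem5p3:
  fixes d :: nat
  assumes "d \<ge> 1"
  shows "(Cont d has_sum fps_recip (\<Prod>i<d. 1 - t_var * q_var ^ i)) (Xset d) \<and>
    (\<forall>n W. card {x \<in> Xset d. vsize d x = n \<and> weight d x = W} =
       card {p \<in> partitions W. size p \<le> n \<and> (\<forall>k \<in># p. k \<le> d - 1)})"
proof -
  \<comment> \<open>With the bound \<open>d - 1\<close>, \<open>config_count\<close> therefore
    counts every configuration of the given size and weight.\<close>
  have "spread d x \<le> d - 1" for x
    using spread_less[OF assms, of x] by simp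
  then have card_eq: "card {x \<in> Xset d. vsize d x = n \<and> weight d x = W} = config_count d n W (d - 1)" for n W
    by (simp add: config_count_def)
  have "(\<Prod>i<d. 1 - t_var * q_var ^ i) * count_fps d (d - 1) = 1"
    using prod_mult_count_fps[of d "d - 1"] assms by simp
  then have "count_fps d (d - 1) = fps_recip (\<Prod>i<d. 1 - t_var * q_var ^ i)"
    by (simp only: fps_recip_unique[OF denominator_nth_0])
  moreover have "(Cont d has_sum count_fps d (d - 1)) (Xset d)"
    using Cont_has_sum[of d] by (simp only: card_eq count_fps_def)
  moreover have "config_count d n W (d - 1) = card (box_partitions n W (d - 1))" for n W
    using assms by (intro config_count_eq_card_box_partitions) auto
  ultimately show ?thesis
    by (simp add: card_eq box_partitions_def)
qed

end
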